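(* Let $(E,\|\cdot\|)$ be a Banach space over a valued field $(\mathbb{K},|\cdot|)$. Let $r>0$, $x\in E$, and let $f\colon B_r(x)\to E$ be a mapping. Suppose that there exists $A\in\mathrm{GL}(E)$ such that $$\sigma:=\sup\left\{\frac{\|f(z)-f(y)-A(z-y)\|}{\|z-y\|}\colon y,z\in B_r(x),\ y\neq z\right\}<\frac{1}{\|A^{-1}\|}.$$ Then the following holds: (a) $f$ has open image and is a homeomorphism onto its image. (b) The inverse map $f^{-1}\colon f(B_r(x))\to B_r(x)$ is Lipschitz, with $\mathrm{Lip}(f^{-1})\le\dfrac{1}{\|A^{-1}\|^{-1}-\sigma}$. (c) Setting $a:=\|A^{-1}\|^{-1}-\sigma>0$ and $b:=\|A\|+\sigma$, we have $$a\|z-y\|\le\|f(z)-f(y)\|\le b\|z-y\|\quad\text{for all } y,z\in B_r(x).$$ (d) For every $y\in B_r(x)$ and $s\in\,]0,r-\|y-x\|]$, $$B_{as}(f(y))\subseteq f(B_s(y))\subseteq B_{bs}(f(y)).$$ In particular, $B_{ar}(f(x))\subseteq f(B_r(x))\subseteq B_{br}(f(x))$.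
   Context: A valued field is a field $\mathbb{K}$ with a non-trivial absolute value (inducing a non-discrete topology); completeness of $\mathbb{K}$ is not assumed. A Banach space over $\mathbb{K}$ is a normed $\mathbb{K}$-vector space that is complete in the metric of its norm. $B_s(y)=\{z\in E\colon\|z-y\|<s\}$. $\mathcal{L}(E)$ is the algebra of continuous $\mathbb{K}$-linear maps $E\to E$ with the operator norm $\|\alpha\|=\sup\{\|\alpha(v)\|/\|v\|\colon 0\ne v\in E\}$, and $\mathrm{GL}(E)=\mathcal{L}(E)^\times$ is its group of invertible elements. A map $g$ between subsets of normed spaces is Lipschitz if $\|g(u)-g(v)\|\le L\|u-v\|$ for some $L\in[0,\infty[$ and all $u,v$; $\mathrm{Lip}(g)$ denotes the smallest such $L$. *)

theory Defs
  imports "HOL-Analysis.Analysis"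
begin

text \<open>
  \<^const>\<open>norm\<close> is constrained to real normed spaces in the library, so the absolute value of the
  field and the norm of the space get a constant of their own. The triangle inequality,
  definiteness and symmetry of \<open>vnorm\<close> are not restated: they follow from \<^class>\<open>metric_space\<close> and
  \<open>dist_vnorm\<close> (with \<open>vnorm v = dist v 0\<close>), which also make the topology the one induced by \<open>vnorm\<close>.
\<close>

class normed_ab_group = ab_group_add + metric_space +
  fixes vnorm :: "'a \<Rightarrow> real"
  assumes dist_vnorm: "dist x y = vnorm (x - y)"

class valued_field = field + normed_ab_group +
  assumes vnorm_mult: "vnorm (a * b) = vnorm a * vnorm b"
    and vnorm_nontrivial: "\<exists>a. a \<noteq> 0 \<and> vnorm a \<noteq> 1"

locale valued_banach_space = vector_space smul
  for smul :: "'k::valued_field \<Rightarrow> 'e::{normed_ab_group, complete_space} \<Rightarrow> 'e" +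
  assumes vnorm_smul: "vnorm (smul c v) = vnorm c * vnorm v"

definition continuous_endos ::
    "('k::valued_field \<Rightarrow> 'e::{normed_ab_group, complete_space} \<Rightarrow> 'e) \<Rightarrow> ('e \<Rightarrow> 'e) set"
  where "continuous_endos smul = {\<alpha>. Vector_Spaces.linear smul smul \<alpha> \<and> continuous_on UNIV \<alpha>}"

definition GL ::
    "('k::valued_field \<Rightarrow> 'e::{normed_ab_group, complete_space} \<Rightarrow> 'e) \<Rightarrow> ('e \<Rightarrow> 'e) set"
  where "GL smul = {\<alpha> \<in> continuous_endos smul.
    \<exists>\<beta> \<in> continuous_endos smul. \<alpha> \<circ> \<beta> = id \<and> \<beta> \<circ> \<alpha> = id}"

text \<open>
  The supremum is finite for every continuous linear map, since the absolute value is non-trivial.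
  On the zero space it is \<open>-\<infinity>\<close> (empty supremum), and the operator norm is \<open>0\<close>.
\<close>

definition op_norm :: "('e::{normed_ab_group, complete_space} \<Rightarrow> 'e) \<Rightarrow> real"
  where "op_norm \<alpha> = real_of_ereal (SUP v \<in> {v. v \<noteq> 0}. ereal (vnorm (\<alpha> v) / vnorm v))"

text \<open>Meaningful only if \<open>g\<close> is Lipschitz on \<open>S\<close>; then the least constant exists.\<close>

definition Lip :: "'a::metric_space set \<Rightarrow> ('a \<Rightarrow> 'b::metric_space) \<Rightarrow> real"
  where "Lip S g = (LEAST L. L-lipschitz_on S g)"

end

theory Submission
  imports Defs
begin

text \<open>
  The map \<open>f\<close> is a perturbation of the isomorphism \<open>A\<close>: the difference \<open>f - A\<close> is Lipschitz with
  constant \<open>\<sigma>\<close>, while \<open>A\<close> stretches every vector at least by the factor \<open>1 / \<parallel>A\<inverse>\<parallel> > \<sigma>\<close> and at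
  most by the factor \<open>\<parallel>A\<parallel>\<close>. The rates \<open>a = 1 / \<parallel>A\<inverse>\<parallel> - \<sigma>\<close> and \<open>b = \<parallel>A\<parallel> + \<sigma>\<close> result in the two-sided estimate of \<open>\<parallel>f z - f y\<parallel>\<close>, and its lower half says at
  once that \<open>f\<close> is injective with a Lipschitz inverse.

  Surjectivity onto balls comes from completeness. A solution of \<open>f z = w\<close> is a fixed point of the
  simplified Newton map \<open>z \<mapsto> z - A\<inverse> (f z - w)\<close>, with \<open>A\<close> in the place of a derivative. It contracts with
  factor \<open>\<parallel>A\<inverse>\<parallel> \<sigma> < 1\<close>, and it maps the closed ball around \<open>y\<close> of radius \<open>\<parallel>w - f y\<parallel> / a\<close> into
  itself, so Banach's fixed point theorem applies (lemma \<open>ball_subset_image_ball\<close>). Each image point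
  thereby has a ball around it inside the image, so the image is open.

  Because the absolute value is non-trivial, continuous linear maps are bounded (lemma
  \<open>continuous_linear_bounded\<close>); this makes the operator norms of \<open>A\<close> and \<open>A\<inverse>\<close> finite and hence
  genuine bounds, from which everything above starts.
\<close>

section \<open>Norms and least Lipschitz constants\<close>

lemma vnorm_eq_dist: "vnorm v = dist v (0::'a::normed_ab_group)"
  by (simp add: dist_vnorm)

lemma vnorm_nonneg [simp]: "0 \<le> vnorm (v::'a::normed_ab_group)"
  by (simp add: vnorm_eq_dist)

lemma vnorm_zero [simp]: "vnorm (0::'a::normed_ab_group) = 0"
  by (simp add: vnorm_eq_dist)

lemma vnorm_eq_0_iff [simp]: "vnorm (v::'a::normed_ab_group) = 0 \<longleftrightarrow> v = 0"
  by (simp add: vnorm_eq_dist)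

lemma vnorm_pos_iff [simp]: "0 < vnorm (v::'a::normed_ab_group) \<longleftrightarrow> v \<noteq> 0"
  by (simp add: vnorm_eq_dist)

lemma vnorm_le_0_iff [simp]: "vnorm (v::'a::normed_ab_group) \<le> 0 \<longleftrightarrow> v = 0"
  by (simp add: vnorm_eq_dist)

lemma vnorm_minus_commute: "vnorm (u - v) = vnorm (v - (u::'a::normed_ab_group))"
  by (metis dist_commute dist_vnorm)

lemma vnorm_diff_triangle: "vnorm u \<le> vnorm v + vnorm (u - (v::'a::normed_ab_group))"
  using dist_triangle[of u 0 v] by (simp add: dist_vnorm)

lemma ball_subset_ball:
  fixes x y :: "'a::normed_ab_group"
  assumes "vnorm (y - x) + s \<le> r"
  shows "ball y s \<subseteq> ball x r"
proof
  fix z assume "z \<in> ball y s"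
  then show "z \<in> ball x r"
    using assms dist_triangle[of x z y] by (simp add: dist_vnorm vnorm_minus_commute[of x y])
qed

lemma vnorm_one [simp]: "vnorm (1::'k::valued_field) = 1"
  using vnorm_mult[of "1::'k" 1] by simp

lemma vnorm_inverse: "vnorm (inverse (c::'k::valued_field)) = inverse (vnorm c)"
proof (cases "c = 0")
  case False
  then have "vnorm c * vnorm (inverse c) = 1"
    by (simp flip: vnorm_mult)
  then show ?thesis
    by (simp add: inverse_unique)
qed simp

lemma vnorm_power: "vnorm ((c::'k::valued_field) ^ n) = vnorm c ^ n"
  by (induction n) (simp_all add: vnorm_mult)

lemma vnorm_power_int: "vnorm ((c::'k::valued_field) powi n) = vnorm c powi n"
  by (simp add: power_int_def vnorm_power vnorm_inverse)

lemma valued_field_large_element: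
  obtains c :: "'k::valued_field" where "vnorm c > 1"
proof -
  obtain d :: 'k where d: "d \<noteq> 0" "vnorm d \<noteq> 1"
    using vnorm_nontrivial by blast
  show thesis
  proof (cases "vnorm d > 1")
    case False
    with d have "vnorm (inverse d) > 1"
      by (simp add: vnorm_inverse one_less_inverse_iff)
    then show thesis by (rule that)
  qed (rule that)
qed

text \<open>
  The Lipschitz constants of a map form a set that is closed under infima, because each of the
  defining inequalities passes to the limit; the least constant is therefore attained.
\<close>

lemma Lip_le:
  assumes "L-lipschitz_on S g"
  shows "Lip S g \<le> L"
proof -
  let ?C = "{L. L-lipschitz_on S g}"
  have bdd: "bdd_below ?C"
    by (rule bdd_belowI[of _ 0]) (simp add: lipschitz_on_def)
  have ne: "?C \<noteq> {}"
    using assms by blast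
  have "(Inf ?C)-lipschitz_on S g"
  proof (rule lipschitz_onI)
    show "0 \<le> Inf ?C"
      using ne by (intro cInf_greatest) (auto simp: lipschitz_on_def)
    fix u v assume uv: "u \<in> S" "v \<in> S"
    show "dist (g u) (g v) \<le> Inf ?C * dist u v"
    proof (cases "u = v")
      case False
      have "dist (g u) (g v) / dist u v \<le> Inf ?C"
        using ne uv False
        by (intro cInf_greatest) (auto simp: divide_le_eq lipschitz_onD)
      with False show ?thesis
        by (simp add: divide_le_eq)
    qed simp
  qed
  then have "Lip S g = Inf ?C"
    unfolding Lip_def by (rule Least_equality) (simp add: cInf_lower bdd)
  also have "\<dots> \<le> L"
    using assms bdd by (simp add: cInf_lower)
  finally show ?thesis .
qed

section \<open>Operator norms over a valued field\<close>

text \<open>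
  Over a general valued field a vector cannot be scaled to any prescribed length. Powers of a scalar
  \<open>c\<close> with \<open>\<bar>c\<bar> > 1\<close> bring it to a length between \<open>\<epsilon> / \<bar>c\<bar>\<close> and \<open>\<epsilon>\<close>, which still bounds
  a continuous linear map, at the cost of a factor \<open>\<bar>c\<bar>\<close>.
\<close>

lemma (in valued_banach_space) continuous_linear_bounded:
  assumes "\<alpha> \<in> continuous_endos smul"
  obtains C where "\<And>v. vnorm (\<alpha> v) \<le> C * vnorm v"
proof -
  interpret \<alpha>: Vector_Spaces.linear smul smul \<alpha>
    using assms by (simp add: continuous_endos_def)
  have "continuous (at 0) \<alpha>"
    using assms by (simp add: continuous_endos_def continuous_on_eq_continuous_at)
  then obtain \<delta> where \<delta>: "\<delta> > 0" "\<And>v. dist v 0 < \<delta> \<Longrightarrow> dist (\<alpha> v) (\<alpha> 0) < 1"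
    unfolding continuous_at_eps_delta by (metis zero_less_one)
  define \<epsilon> where "\<epsilon> = \<delta> / 2"
  have \<epsilon>: "\<epsilon> > 0" "\<And>v. vnorm v \<le> \<epsilon> \<Longrightarrow> vnorm (\<alpha> v) \<le> 1"
    using \<delta> by (force simp: \<epsilon>_def vnorm_eq_dist \<alpha>.zero less_imp_le)+
  obtain c :: 'k where c: "vnorm c > 1"
    by (rule valued_field_large_element)
  let ?q = "vnorm c"
  have "c \<noteq> 0"
    using c by auto
  then have powr: "?q powr real_of_int n = ?q powi n" for n
    by (simp add: powr_real_of_int')
  show thesis
  proof (rule that[of "?q / \<epsilon>"])
    fix v
    show "vnorm (\<alpha> v) \<le> ?q / \<epsilon> * vnorm v"
    proof (cases "v = 0")
      case False
      \<comment> \<open>The \<open>n\<close>-th power of \<open>\<bar>c\<bar>\<close> is the largest one that does not exceed \<open>\<epsilon> / \<parallel>v\<parallel>\<close>.\<close>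
      define n where "n = \<lfloor>log ?q (\<epsilon> / vnorm v)\<rfloor>"
      have u: "\<epsilon> / vnorm v > 0"
        using False \<epsilon> by simp
      have "real_of_int n \<le> log ?q (\<epsilon> / vnorm v)"
        by (simp add: n_def)
      then have "?q powr real_of_int n \<le> \<epsilon> / vnorm v"
        using c u by (simp add: le_log_iff)
      then have le: "?q powi n \<le> \<epsilon> / vnorm v"
        by (simp only: powr)
      have "log ?q (\<epsilon> / vnorm v) < real_of_int (n + 1)"
        unfolding n_def by linarith
      then have "\<epsilon> / vnorm v < ?q powr real_of_int (n + 1)"
        using c u by (simp add: log_less_iff)
      also have "\<dots> = ?q * ?q powi n"
        using c by (simp add: powr powr_add)
      finally have gt: "\<epsilon> / vnorm v < ?q * ?q powi n" .
      have q: "?q powi n > 0"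
        using \<open>c \<noteq> 0\<close> by (simp add: zero_less_power_int)
      have "vnorm (smul (c powi n) v) \<le> \<epsilon>"
        using le False by (simp add: vnorm_smul vnorm_power_int pos_le_divide_eq)
      then have "vnorm (\<alpha> (smul (c powi n) v)) \<le> 1"
        by (rule \<epsilon>)
      then have "?q powi n * vnorm (\<alpha> v) \<le> 1"
        by (simp add: \<alpha>.scale vnorm_smul vnorm_power_int)
      also have "1 < ?q powi n * (?q / \<epsilon> * vnorm v)"
        using gt \<epsilon> False by (simp add: field_simps)
      finally show ?thesis
        using q by (simp only: mult_less_cancel_left_pos less_imp_le)
    qed (simp add: \<alpha>.zero)
  qed
qed

lemma (in valued_banach_space) vnorm_le_op_norm:
  assumes "\<alpha> \<in> continuous_endos smul"
  shows "vnorm (\<alpha> v) \<le> op_norm \<alpha> * vnorm v"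
proof (cases "v = 0")
  case True
  interpret \<alpha>: Vector_Spaces.linear smul smul \<alpha>
    using assms by (simp add: continuous_endos_def)
  show ?thesis
    by (simp add: True \<alpha>.zero)
next
  case False
  let ?S = "SUP v \<in> {v. v \<noteq> 0}. ereal (vnorm (\<alpha> v) / vnorm v)"
  obtain C where C: "\<And>v. vnorm (\<alpha> v) \<le> C * vnorm v"
    using continuous_linear_bounded[OF assms] by blast
  have upper: "?S \<le> ereal C"
    using C by (intro SUP_least) (simp add: divide_le_eq)
  have lower: "ereal (vnorm (\<alpha> v) / vnorm v) \<le> ?S"
    using False by (intro SUP_upper) simp
  have "?S = ereal (op_norm \<alpha>)"
    unfolding op_norm_def using upper lower by (intro ereal_real'[symmetric]) auto
  with lower False show ?thesis
    by (simp add: divide_le_eq)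
qed

lemma (in valued_banach_space) GL_inv_continuous_endos_bij:
  assumes "A \<in> GL smul"
  shows "inv A \<in> continuous_endos smul" and "bij A"
proof -
  obtain \<beta> where \<beta>: "\<beta> \<in> continuous_endos smul" "A \<circ> \<beta> = id" "\<beta> \<circ> A = id"
    using assms by (auto simp: GL_def)
  then have "inv A = \<beta>"
    by (intro inv_unique_comp)
  with \<beta> show "inv A \<in> continuous_endos smul"
    by simp
  show "bij A"
    using \<beta> o_bij by blast
qed

section \<open>Perturbations of an isomorphism\<close>

text \<open>
  The map \<open>A\<close> stretches \<open>v = z - y\<close> to a length of at least \<open>\<parallel>v\<parallel> / M\<close>, and the error of the linear
  approximation can cancel at most \<open>\<sigma> \<parallel>v\<parallel>\<close> of this.
\<close>

lemma perturbation_lower_bound: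
  fixes A :: "'e::normed_ab_group \<Rightarrow> 'e"
  assumes "0 < M" and "vnorm (z - y) \<le> M * vnorm (A (z - y))"
    and "vnorm (f z - f y - A (z - y)) \<le> \<sigma> * vnorm (z - y)"
  shows "(1 / M - \<sigma>) * vnorm (z - y) \<le> vnorm (f z - f y)"
proof -
  have "vnorm (z - y) / M \<le> vnorm (A (z - y))"
    using assms by (simp add: divide_le_eq mult.commute)
  also have "\<dots> \<le> vnorm (f z - f y) + vnorm (f z - f y - A (z - y))"
    using vnorm_diff_triangle[of "A (z - y)" "f z - f y"]
    by (simp add: vnorm_minus_commute)
  finally show ?thesis
    using assms(3) by (simp add: algebra_simps)
qed

text \<open>
  Let \<open>a = 1 / M - \<sigma>\<close>. For \<open>w\<close> in the ball on the left, the Newton map \<open>z \<mapsto> z - B (f z - w)\<close> has its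
  fixed point in the closed ball around \<open>y\<close> of radius \<open>\<parallel>w - f y\<parallel> / a\<close>.
  This radius is the one for which the first Newton step, of length at most
  \<open>M \<parallel>w - f y\<parallel>\<close>, and the contraction of the ball add up to the radius again. It is smaller than \<open>s\<close>
  exactly when \<open>w\<close> lies in the open ball of radius \<open>a s\<close>.
\<close>

lemma ball_subset_image_ball:
  fixes A B :: "'e::{normed_ab_group, complete_space} \<Rightarrow> 'e"
  assumes M: "0 < M" and \<sigma>: "0 \<le> \<sigma>" "\<sigma> < 1 / M"
    and B_diff: "\<And>u v. B (u - v) = B u - B v" and BA: "\<And>v. B (A v) = v"
    and B_bound: "\<And>v. vnorm (B v) \<le> M * vnorm v"
    and B_inj: "\<And>v. B v = 0 \<Longrightarrow> v = 0"
    and approx: "\<And>u v. \<lbrakk>u \<in> ball y s; v \<in> ball y s\<rbrakk>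
      \<Longrightarrow> vnorm (f v - f u - A (v - u)) \<le> \<sigma> * vnorm (v - u)"
  shows "ball (f y) ((1 / M - \<sigma>) * s) \<subseteq> f ` ball y s"
proof
  fix w assume w: "w \<in> ball (f y) ((1 / M - \<sigma>) * s)"
  define a where "a = 1 / M - \<sigma>"
  have a: "a > 0"
    using \<sigma> by (simp add: a_def)
  define t where "t = vnorm (f y - w) / a"
  define g where "g z = z - B (f z - w)" for z
  have "0 \<le> t"
    using a by (simp add: t_def)
  have "t < s"
    using w a by (simp add: t_def a_def[symmetric] dist_vnorm divide_less_eq mult.commute)
  then have sub: "cball y t \<subseteq> ball y s"
    by auto
  have contr: "dist (g u) (g v) \<le> M * \<sigma> * dist u v" if "u \<in> ball y s" "v \<in> ball y s" for u v
  proof -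
    have "B (f v - f u - A (v - u)) = B ((f v - w) - (f u - w)) - B (A (v - u))"
      by (simp add: B_diff)
    also have "\<dots> = g u - g v"
      by (simp add: BA B_diff g_def)
    finally have "dist (g u) (g v) = vnorm (B (f v - f u - A (v - u)))"
      by (simp add: dist_vnorm)
    also have "\<dots> \<le> M * vnorm (f v - f u - A (v - u))"
      by (rule B_bound)
    also have "\<dots> \<le> M * (\<sigma> * vnorm (v - u))"
      using M approx[OF that] by (intro mult_left_mono) auto
    finally show ?thesis
      by (simp add: dist_vnorm vnorm_minus_commute[of u v] mult.assoc)
  qed
  have "g ` cball y t \<subseteq> cball y t"
  proof (rule image_subsetI)
    fix u assume u: "u \<in> cball y t"
    have "dist y (g u) \<le> dist y (g y) + dist (g y) (g u)"
      by (rule dist_triangle)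
    also have "dist y (g y) \<le> M * (a * t)"
      using B_bound[of "f y - w"] a by (simp add: dist_vnorm g_def t_def)
    also have "dist (g y) (g u) \<le> M * \<sigma> * dist y u"
      using u \<open>0 \<le> t\<close> \<open>t < s\<close> by (intro contr) (auto intro: le_less_trans[OF _ \<open>t < s\<close>])
    also have "\<dots> \<le> M * \<sigma> * t"
      using u M \<sigma> by (intro mult_left_mono) auto
    also have "M * (a * t) + M * \<sigma> * t = t"
      using M by (simp add: a_def field_simps)
    finally show "g u \<in> cball y t"
      by simp
  qed
  moreover have "\<forall>u\<in>cball y t. \<forall>v\<in>cball y t. dist (g u) (g v) \<le> M * \<sigma> * dist u v"
    using contr sub by blast
  moreover have "complete (cball y t)"
    by (simp add: complete_eq_closed)
  moreover have "M * \<sigma> < 1"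
    using M \<sigma> by (simp add: field_simps)
  ultimately obtain z where z: "z \<in> cball y t" "g z = z"
    using Banach_fix[of "cball y t" "M * \<sigma>" g] M \<sigma> \<open>0 \<le> t\<close> by auto
  then have "B (f z - w) = 0"
    by (simp add: g_def)
  then have "f z = w"
    using B_inj[of "f z - w"] by simp
  with z sub show "w \<in> f ` ball y s"
    by blast
qed

section \<open>The inverse function theorem\<close>

theorem theorem5p3:
  fixes smul :: "'k::valued_field \<Rightarrow> 'e::{normed_ab_group, complete_space} \<Rightarrow> 'e"
    and f A :: "'e \<Rightarrow> 'e" and x :: 'e and r \<sigma> a b :: real
  assumes "valued_banach_space smul"
    and "r > 0"
    and "A \<in> GL smul"
    and "ereal \<sigma> = (SUP (y, z) \<in> {(y, z). y \<in> ball x r \<and> z \<in> ball x r \<and> y \<noteq> z}.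
            ereal (vnorm (f z - f y - A (z - y)) / vnorm (z - y)))"
    and "\<sigma> < 1 / op_norm (inv A)"
    and "a = 1 / op_norm (inv A) - \<sigma>"
    and "b = op_norm A + \<sigma>"
  shows
    "(open (f ` ball x r) \<and>
      homeomorphism (ball x r) (f ` ball x r) f (inv_into (ball x r) f)) \<and>
     ((\<exists>L. L-lipschitz_on (f ` ball x r) (inv_into (ball x r) f)) \<and>
      Lip (f ` ball x r) (inv_into (ball x r) f) \<le> 1 / (1 / op_norm (inv A) - \<sigma>)) \<and>
     (a > 0 \<and>
      (\<forall>y \<in> ball x r. \<forall>z \<in> ball x r.
         a * vnorm (z - y) \<le> vnorm (f z - f y) \<and> vnorm (f z - f y) \<le> b * vnorm (z - y))) \<and>
     (\<forall>y \<in> ball x r. \<forall>s. 0 < s \<and> s \<le> r - vnorm (y - x) \<longrightarrow>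
         ball (f y) (a * s) \<subseteq> f ` ball y s \<and> f ` ball y s \<subseteq> ball (f y) (b * s)) \<and>
     (ball (f x) (a * r) \<subseteq> f ` ball x r \<and> f ` ball x r \<subseteq> ball (f x) (b * r))"
proof -
  interpret valued_banach_space smul by fact
  let ?U = "ball x r" and ?M = "op_norm (inv A)"
  have A: "A \<in> continuous_endos smul"
    using \<open>A \<in> GL smul\<close> by (simp add: GL_def)
  note B = GL_inv_continuous_endos_bij(1)[OF \<open>A \<in> GL smul\<close>]
    and bij = GL_inv_continuous_endos_bij(2)[OF \<open>A \<in> GL smul\<close>]
  interpret B: Vector_Spaces.linear smul smul "inv A"
    using B by (simp add: continuous_endos_def)
  have BA: "inv A (A v) = v" and AB: "A (inv A v) = v" for v
    using bij by (simp_all add: bij_is_inj bij_is_surj surj_f_inv_f)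
  note B_bound = vnorm_le_op_norm[OF B]
  have quotient: "ereal (vnorm (f z - f y - A (z - y)) / vnorm (z - y)) \<le> ereal \<sigma>"
    if "y \<in> ?U" "z \<in> ?U" "y \<noteq> z" for y z
    unfolding assms(4) using that by (intro SUP_upper2[of "(y, z)"]) auto
  have approx: "vnorm (f z - f y - A (z - y)) \<le> \<sigma> * vnorm (z - y)" if "y \<in> ?U" "z \<in> ?U" for y z
  proof (cases "y = z")
    case True
    have "A 0 = 0"
      using BA[of 0] AB[of 0] by (simp add: B.zero)
    with True show ?thesis by simp
  next
    case False
    with quotient[OF that] show ?thesis
      by (simp add: divide_le_eq)
  qed
  \<comment> \<open>The supremum over the empty set would be \<open>-\<infinity>\<close>, so the real number \<open>\<sigma>\<close> forces two points.\<close>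
  obtain p q where pq: "p \<in> ?U" "q \<in> ?U" "p \<noteq> q"
  proof (rule ccontr)
    assume "\<not> thesis"
    then have empty: "{(y, z). y \<in> ?U \<and> z \<in> ?U \<and> y \<noteq> z} = {}"
      using that by auto
    show False
      using assms(4) unfolding empty by (simp add: bot_ereal_def)
  qed
  have "0 \<le> vnorm (f q - f p - A (q - p)) / vnorm (q - p)"
    by simp
  also have "\<dots> \<le> \<sigma>"
    using quotient[OF pq] by simp
  finally have \<sigma>: "0 \<le> \<sigma>" .
  with \<open>\<sigma> < 1 / ?M\<close> have "0 < 1 / ?M"
    by linarith
  then have M: "0 < ?M"
    by simp
  have a: "0 < a"
    using assms by simp

  have lower: "a * vnorm (z - y) \<le> vnorm (f z - f y)" if "y \<in> ?U" "z \<in> ?U" for y z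
    unfolding \<open>a = _\<close>
    using M B_bound[of "A (z - y)"] approx[OF that]
    by (intro perturbation_lower_bound) (simp_all add: BA)
  have upper: "vnorm (f z - f y) \<le> b * vnorm (z - y)" if "y \<in> ?U" "z \<in> ?U" for y z
    using vnorm_diff_triangle[of "f z - f y" "A (z - y)"] vnorm_le_op_norm[OF A, of "z - y"]
      approx[OF that] by (simp add: \<open>b = _\<close> algebra_simps)
  have "a * vnorm (q - p) \<le> b * vnorm (q - p)"
    using lower[OF pq(1,2)] upper[OF pq(1,2)] by simp
  then have b: "0 < b"
    using pq a by (simp add: mult_le_cancel_right)

  have balls: "ball (f y) (a * s) \<subseteq> f ` ball y s \<and> f ` ball y s \<subseteq> ball (f y) (b * s)"
    if y: "y \<in> ?U" and s: "0 < s" "s \<le> r - vnorm (y - x)" for y s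
  proof
    have sub: "ball y s \<subseteq> ?U"
      using s by (intro ball_subset_ball) simp
    show "ball (f y) (a * s) \<subseteq> f ` ball y s"
      unfolding \<open>a = _\<close>
      using M \<sigma> \<open>\<sigma> < 1 / ?M\<close>
    proof (rule ball_subset_image_ball)
      show "inv A (u - v) = inv A u - inv A v" for u v
        by (rule B.diff)
      show "v = 0" if "inv A v = 0" for v
        using that AB[of v] AB[of 0] by (metis B.zero)
      show "vnorm (f v - f u - A (v - u)) \<le> \<sigma> * vnorm (v - u)"
        if "u \<in> ball y s" "v \<in> ball y s" for u v
        using that sub by (intro approx) auto
    qed (use BA B_bound in auto)
    show "f ` ball y s \<subseteq> ball (f y) (b * s)"
    proof (rule image_subsetI)
      fix z assume z: "z \<in> ball y s"
      have "vnorm (f z - f y) \<le> b * vnorm (z - y)"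
        using z sub y by (intro upper) auto
      also have "\<dots> < b * s"
        using z b by (simp add: dist_vnorm vnorm_minus_commute)
      finally show "f z \<in> ball (f y) (b * s)"
        by (simp add: dist_vnorm vnorm_minus_commute)
    qed
  qed

  have inj: "inj_on f ?U"
  proof (rule inj_onI)
    fix y z assume "y \<in> ?U" "z \<in> ?U" "f y = f z"
    with lower[of y z] a show "y = z"
      by (simp add: mult_le_0_iff)
  qed
  let ?g = "inv_into ?U f"
  have g_lipschitz: "(1 / a)-lipschitz_on (f ` ?U) ?g"
  proof (rule lipschitz_onI)
    fix u v assume uv: "u \<in> f ` ?U" "v \<in> f ` ?U"
    have "a * dist (?g u) (?g v) \<le> dist u v"
      using lower[OF inv_into_into[OF uv(2)] inv_into_into[OF uv(1)]] uv
      by (simp add: dist_vnorm f_inv_into_f)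
    with a show "dist (?g u) (?g v) \<le> 1 / a * dist u v"
      by (simp add: field_simps)
  qed (use a in simp)
  have f_lipschitz: "b-lipschitz_on ?U f"
    using upper b by (intro lipschitz_onI) (simp_all add: dist_vnorm)
  have "homeomorphism ?U (f ` ?U) f ?g"
    using inj lipschitz_on_continuous_on[OF f_lipschitz] lipschitz_on_continuous_on[OF g_lipschitz]
    by (intro homeomorphismI) (auto simp: f_inv_into_f inv_into_into)
  moreover have "open (f ` ?U)"
  proof -
    have "\<exists>e>0. ball (f y) e \<subseteq> f ` ?U" if "y \<in> ?U" for y
    proof (intro exI conjI)
      let ?s = "r - vnorm (y - x)"
      have s: "0 < ?s"
        using that by (simp add: dist_vnorm vnorm_minus_commute)
      then show "0 < a * ?s"
        using a by simp
      have "ball (f y) (a * ?s) \<subseteq> f ` ball y ?s"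
        using balls that s by blast
      also have "\<dots> \<subseteq> f ` ?U"
        by (intro image_mono ball_subset_ball) simp
      finally show "ball (f y) (a * ?s) \<subseteq> f ` ?U" .
    qed
    then show ?thesis
      by (auto simp: open_contains_ball)
  qed
  moreover have "\<exists>L. L-lipschitz_on (f ` ?U) ?g"
    using g_lipschitz by blast
  moreover have "Lip (f ` ?U) ?g \<le> 1 / (1 / ?M - \<sigma>)"
    using Lip_le[OF g_lipschitz] by (simp add: \<open>a = _\<close>)
  moreover have "ball (f x) (a * r) \<subseteq> f ` ?U \<and> f ` ?U \<subseteq> ball (f x) (b * r)"
    using \<open>r > 0\<close> by (intro balls) simp_all
  ultimately show ?thesis
    using a lower upper balls by simp
qed

end
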